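(* Let $R=K[x_1,\ldots,x_n]$ be the polynomial ring over a field $K$ and let $I\subset R$ be a homogeneous ideal. Assume that $<$ is a monomial order on $R$ such that the initial ideal $\operatorname{in}_<(I)$ is a square-free monomial ideal (in particular, $I$ is a radical ideal). Let $\operatorname{Min}(I)=\{\mathfrak p_1,\ldots,\mathfrak p_s\}$ be the set of minimal prime ideals of $I$, so that $I=\bigcap_{i=1}^s\mathfrak p_i$. Assume that the following conditions hold: (i) $\operatorname{in}_<(I)=\bigcap_{i=1}^s \operatorname{in}_<(\mathfrak p_i)$; (ii) for an integer $t\geq 1$ we have: (a) $\mathfrak p_i^{(t)}=\mathfrak p_i^t$ for $1\leq i\leq s$; (b) $\operatorname{in}_<(\mathfrak p_i^t)=(\operatorname{in}_<(\mathfrak p_i))^t$ for $1\leq i\leq s$; (c) $(\operatorname{in}_<(I))^{(t)}=(\operatorname{in}_<(I))^t$. Then $I^{(t)}=I^t$ (for this same integer $t$).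
   Context: For an ideal $I$ in a Noetherian ring $R$ with set of minimal primes $\operatorname{Min}(I)$ and an integer $k\ge 1$, the $k$-th symbolic power of $I$ is $I^{(k)}=\bigcap_{\mathfrak p\in\operatorname{Min}(I)}(I^kR_{\mathfrak p}\cap R)$, equivalently $I^{(k)}=\{a\in R:\text{ there exists } w\notin\bigcup_{\mathfrak p\in\operatorname{Min}(I)}\mathfrak p \text{ with } wa\in I^k\}$. For a monomial order $<$ on a polynomial ring, $\operatorname{in}_<(I)$ denotes the initial ideal of $I$, i.e. the ideal generated by the leading monomials with respect to $<$ of the nonzero elements of $I$. *)

theory Defs
  imports
    "HOL-Library.Poly_Mapping"
    "HOL-Algebra.Ideal_Product"
    "HOL-Algebra.Algebraic_Closure_Type"
begin

section \<open>Symbolic powers of ideals in a commutative ring\<close>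

text \<open>The ideals of \<open>R\<close> form a monoid \<^const>\<open>ideals_set\<close> under ideal multiplication
  with neutral element \<open>carrier R\<close>; the ordinary power of an ideal is the power there.\<close>

abbreviation ideal_power :: "('r, 'm) ring_scheme \<Rightarrow> 'r set \<Rightarrow> nat \<Rightarrow> 'r set" where
  "ideal_power R I k \<equiv> I [^]\<^bsub>ideals_set R\<^esub> k"

definition minimal_primes :: "('r, 'm) ring_scheme \<Rightarrow> 'r set \<Rightarrow> 'r set set" where
  "minimal_primes R I =
     {P. primeideal P R \<and> I \<subseteq> P \<and> (\<forall>Q. primeideal Q R \<and> I \<subseteq> Q \<and> Q \<subseteq> P \<longrightarrow> Q = P)}"

definition symbolic_power :: "('r, 'm) ring_scheme \<Rightarrow> 'r set \<Rightarrow> nat \<Rightarrow> 'r set" where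
  "symbolic_power R I k =
     {a \<in> carrier R. \<exists>w \<in> carrier R. w \<notin> \<Union>(minimal_primes R I) \<and> w \<otimes>\<^bsub>R\<^esub> a \<in> ideal_power R I k}"


section \<open>Polynomial rings, monomial orders and initial ideals\<close>

text \<open>The variables are indexed by a finite type \<open>'n\<close>. A monomial is represented by its
  exponent vector in \<open>'n \<Rightarrow>\<^sub>0 nat\<close>, so multiplication of monomials is addition of exponent
  vectors and the monomial \<open>1\<close> is the exponent vector \<open>0\<close>.\<close>

type_synonym 'n monomial = "'n \<Rightarrow>\<^sub>0 nat"
type_synonym ('n, 'k) mpolynomial = "'n monomial \<Rightarrow>\<^sub>0 'k"

abbreviation polynomial_ring :: "('n::finite, 'k::field) mpolynomial ring" where
  "polynomial_ring \<equiv> ring_of_type_algebra"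

abbreviation monomial_poly :: "'n monomial \<Rightarrow> ('n::finite, 'k::field) mpolynomial" where
  "monomial_poly m \<equiv> Poly_Mapping.single m 1"

definition monomial_degree :: "'n::finite monomial \<Rightarrow> nat" where
  "monomial_degree m = (\<Sum>i\<in>UNIV. Poly_Mapping.lookup m i)"

text \<open>The zero polynomial counts as homogeneous.\<close>

definition homogeneous_poly :: "('n::finite, 'k::field) mpolynomial \<Rightarrow> bool" where
  "homogeneous_poly f \<longleftrightarrow> (\<exists>d. \<forall>m \<in> Poly_Mapping.keys f. monomial_degree m = d)"

definition homogeneous_ideal :: "('n::finite, 'k::field) mpolynomial set \<Rightarrow> bool" where
  "homogeneous_ideal I \<longleftrightarrow> (\<exists>S. (\<forall>f\<in>S. homogeneous_poly f) \<and> I = Idl\<^bsub>polynomial_ring\<^esub> S)"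

definition squarefree_monomial_ideal :: "('n::finite, 'k::field) mpolynomial set \<Rightarrow> bool" where
  "squarefree_monomial_ideal I \<longleftrightarrow>
     (\<exists>M. (\<forall>m\<in>M. \<forall>i. Poly_Mapping.lookup m i \<le> 1) \<and> I = Idl\<^bsub>polynomial_ring\<^esub> (monomial_poly ` M))"

text \<open>The strict version of the order. That such an order is a well-order is a theorem
  (a consequence of Dickson's lemma), hence not part of the definition.\<close>

definition monomial_order :: "('n::finite monomial \<Rightarrow> 'n monomial \<Rightarrow> bool) \<Rightarrow> bool" where
  "monomial_order lt \<longleftrightarrow>
     irreflp lt \<and> transp lt \<and> totalp lt \<and>
     (\<forall>a b c. lt a b \<longrightarrow> lt (a + c) (b + c)) \<and>
     (\<forall>a. a \<noteq> 0 \<longrightarrow> lt 0 a)"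

text \<open>Only meaningful for \<open>f \<noteq> 0\<close>.\<close>

definition leading_monomial ::
    "('n::finite monomial \<Rightarrow> 'n monomial \<Rightarrow> bool) \<Rightarrow> ('n, 'k::field) mpolynomial \<Rightarrow> 'n monomial" where
  "leading_monomial lt f =
     (THE m. m \<in> Poly_Mapping.keys f \<and> (\<forall>m' \<in> Poly_Mapping.keys f. m' \<noteq> m \<longrightarrow> lt m' m))"

definition initial_ideal ::
    "('n::finite monomial \<Rightarrow> 'n monomial \<Rightarrow> bool) \<Rightarrow>
     ('n, 'k::field) mpolynomial set \<Rightarrow> ('n, 'k) mpolynomial set" where
  "initial_ideal lt I =
     Idl\<^bsub>polynomial_ring\<^esub> {monomial_poly (leading_monomial lt f) | f. f \<in> I \<and> f \<noteq> 0}"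

end

theory Submission
  imports Defs
begin

text \<open>Write \<open>in(I)\<close> as generated by a set \<open>M\<close> of squarefree monomials. Its minimal primes are the ideals
  \<open>P\<^sub>C\<close> generated by the variables in \<open>C\<close>, for \<open>C\<close> a minimal vertex cover of \<open>M\<close>. The polynomials whose
  leading monomial avoids \<open>C\<close> form a multiplicative set disjoint from \<open>I\<close>, so some minimal prime \<open>p\<close>
  of \<open>I\<close> is disjoint from it, that is, \<open>in(p) \<subseteq> P\<^sub>C\<close>. For \<open>a \<in> I\<^sup>(\<^sup>t\<^sup>) \<subseteq> p\<^sup>(\<^sup>t\<^sup>) = p\<^sup>t\<close> the leading
  monomial \<open>x\<^sup>u\<close> of \<open>a\<close> lies in \<open>in(p\<^sup>t) = in(p)\<^sup>t \<subseteq> P\<^sub>C\<^sup>t\<close>, so it has degree at least \<open>t\<close> in the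
  variables of \<open>C\<close>. As this holds for all minimal covers, \<open>x\<^sup>u\<close> is in the symbolic power
  \<open>in(I)\<^sup>(\<^sup>t\<^sup>) = in(I)\<^sup>t \<subseteq> in(I\<^sup>t)\<close>. Hence \<open>I\<^sup>t \<subseteq> I\<^sup>(\<^sup>t\<^sup>)\<close> have the same initial ideal and are equal.\<close>

subsection \<open>Ideals of commutative rings given as types\<close>

abbreviation type_ring :: "'a::comm_ring_1 ring" where
  "type_ring \<equiv> ring_of_type_algebra"

lemma type_ring_simps [simp]:
  "carrier type_ring = UNIV" "monoid.mult type_ring = (*)" "\<one>\<^bsub>type_ring\<^esub> = 1"
  "\<zero>\<^bsub>type_ring\<^esub> = 0" "ring.add type_ring = (+)"
  by (auto simp: ring_of_type_algebra_def fun_eq_iff)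

lemma ring_type_ring: "ring type_ring"
  by (rule ring_from_type_algebra)

lemma cring_type_ring: "cring type_ring"
  by (rule cring_from_type_algebra)

text \<open>Closure under negation is automatic, since \<open>- a = (- 1) * a\<close>, and
  commutativity merges left and right multiples. All later ideal checks go through this elementary
  form.\<close>

lemma ideal_type_ring_iff:
  fixes I :: "'a::comm_ring_1 set"
  shows "ideal I type_ring \<longleftrightarrow> 0 \<in> I \<and> (\<forall>a\<in>I. \<forall>b\<in>I. a + b \<in> I) \<and> (\<forall>a\<in>I. \<forall>x. x * a \<in> I)"
proof
  assume "ideal I type_ring"
  then interpret ideal I "type_ring :: 'a ring" .
  show "0 \<in> I \<and> (\<forall>a\<in>I. \<forall>b\<in>I. a + b \<in> I) \<and> (\<forall>a\<in>I. \<forall>x. x * a \<in> I)"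
    using additive_subgroup.zero_closed[OF additive_subgroup_axioms]
      additive_subgroup.a_closed[OF additive_subgroup_axioms] I_l_closed by auto
next
  assume *: "0 \<in> I \<and> (\<forall>a\<in>I. \<forall>b\<in>I. a + b \<in> I) \<and> (\<forall>a\<in>I. \<forall>x. x * a \<in> I)"
  interpret cring "type_ring :: 'a ring" by (rule cring_type_ring)
  have neg: "- a \<in> I" if "a \<in> I" for a
    using * that by (metis mult_minus1)
  have inv: "inv\<^bsub>add_monoid type_ring\<^esub> a = - a" for a :: 'a
    using minus_equality[of "- a" a] by (simp add: a_inv_def)
  show "ideal I type_ring"
  proof (rule idealI)
    show "ring (type_ring :: 'a ring)" by (rule ring_type_ring)
    show "subgroup I (add_monoid type_ring)"
    proof (rule subgroup.intro)
      show "inv\<^bsub>add_monoid type_ring\<^esub> a \<in> I" if "a \<in> I" for a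
        unfolding inv by (rule neg[OF that])
    qed (use * in auto)
  qed (use * in \<open>auto simp: mult.commute\<close>)
qed

lemma ideal_minus_closed:
  fixes I :: "'a::comm_ring_1 set"
  assumes "ideal I type_ring" "a \<in> I" "b \<in> I"
  shows "a - b \<in> I"
proof -
  have "a + (- 1) * b \<in> I"
    using assms unfolding ideal_type_ring_iff by blast
  then show ?thesis by simp
qed

lemma ideal_sum_closed:
  fixes I :: "'a::comm_ring_1 set"
  assumes "ideal I type_ring" "\<And>x. x \<in> A \<Longrightarrow> f x \<in> I"
  shows "sum f A \<in> I"
  using assms(2)
  by (induction A rule: infinite_finite_induct) (use assms(1) in \<open>auto simp: ideal_type_ring_iff\<close>)

lemma primeideal_type_ring_iff:
  fixes P :: "'a::comm_ring_1 set"
  shows "primeideal P type_ring \<longleftrightarrow>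
    ideal P type_ring \<and> 1 \<notin> P \<and> (\<forall>a b. a * b \<in> P \<longrightarrow> a \<in> P \<or> b \<in> P)"
proof
  assume "primeideal P type_ring"
  then interpret primeideal P "type_ring :: 'a ring" .
  show "ideal P type_ring \<and> 1 \<notin> P \<and> (\<forall>a b. a * b \<in> P \<longrightarrow> a \<in> P \<or> b \<in> P)"
    using is_ideal I_prime I_notcarr one_imp_carrier by auto
next
  assume "ideal P type_ring \<and> 1 \<notin> P \<and> (\<forall>a b. a * b \<in> P \<longrightarrow> a \<in> P \<or> b \<in> P)"
  then show "primeideal P type_ring"
    by (intro primeidealI cring_type_ring) auto
qed

lemma primeideal_power_mem:
  fixes P :: "'a::comm_ring_1 set"
  assumes "primeideal P type_ring" "a ^ n \<in> P"
  shows "a \<in> P"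
  using assms(2)
  by (induction n) (use assms(1) in \<open>auto simp: primeideal_type_ring_iff\<close>)

section \<open>Products, powers and generation of ideals\<close>

lemma ideals_set_type_ring_simps [simp]:
  "\<one>\<^bsub>ideals_set type_ring\<^esub> = (UNIV :: 'a::comm_ring_1 set)"
  "monoid.mult (ideals_set type_ring) = (ideal_prod type_ring :: 'a set \<Rightarrow> 'a set \<Rightarrow> 'a set)"
  by (simp_all add: ideals_set_def)

lemma ideal_power_Suc [simp]:
  "ideal_power type_ring (I :: 'a::comm_ring_1 set) (Suc n) =
     ideal_prod type_ring (ideal_power type_ring I n) I"
  by (simp add: nat_pow_def)

lemma ideal_ideal_power:
  "ideal (I :: 'a::comm_ring_1 set) type_ring \<Longrightarrow> ideal (ideal_power type_ring I n) type_ring"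
proof (induction n)
  case 0
  then show ?case by (simp add: ideal_type_ring_iff)
next
  case (Suc n)
  then show ?case using ring.ideal_prod_is_ideal[OF ring_type_ring] by simp
qed

lemma ideal_prod_least:
  assumes "ideal K type_ring" "\<And>a b. a \<in> I \<Longrightarrow> b \<in> J \<Longrightarrow> a * b \<in> K"
  shows "ideal_prod type_ring I J \<subseteq> (K :: 'a::comm_ring_1 set)"
proof
  fix x
  assume "x \<in> ideal_prod type_ring I J"
  then show "x \<in> K"
    by induction (use assms in \<open>auto simp: ideal_type_ring_iff\<close>)
qed

lemma mult_mem_ideal_prod:
  "a \<in> I \<Longrightarrow> b \<in> J \<Longrightarrow> a * b \<in> ideal_prod type_ring I (J :: 'a::comm_ring_1 set)"
  using ideal_prod.prod[of a I b J type_ring] by simp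

lemma ideal_power_mono:
  fixes I J :: "'a::comm_ring_1 set"
  assumes "ideal J type_ring" "I \<subseteq> J"
  shows "ideal_power type_ring I n \<subseteq> ideal_power type_ring J n"
proof (induction n)
  case (Suc n)
  show ?case
    unfolding ideal_power_Suc
    using Suc assms ideal_ideal_power[OF assms(1), of "Suc n"]
    by (intro ideal_prod_least) (auto intro: mult_mem_ideal_prod)
qed simp

lemma ideal_genideal: "ideal (Idl\<^bsub>type_ring\<^esub> S) (type_ring :: 'a::comm_ring_1 ring)"
  by (rule ring.genideal_ideal[OF ring_type_ring]) simp

lemma genideal_least:
  "ideal K (type_ring :: 'a::comm_ring_1 ring) \<Longrightarrow> S \<subseteq> K \<Longrightarrow> Idl\<^bsub>type_ring\<^esub> S \<subseteq> K"
  by (rule ring.genideal_minimal[OF ring_type_ring])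

lemma genideal_superset: "S \<subseteq> Idl\<^bsub>type_ring\<^esub> (S :: 'a::comm_ring_1 set)"
  by (rule ring.genideal_self[OF ring_type_ring]) simp


subsection \<open>Minimal primes and symbolic powers\<close>

text \<open>Krull's argument: if \<open>a\<close> and \<open>b\<close> lie outside \<open>P\<close>,
  then by maximality \<open>P + (a)\<close> and \<open>P + (b)\<close> both meet \<open>S\<close>.
  The product of two such elements lies in \<open>S\<close>, and it lies in \<open>P\<close> as soon
  as \<open>a * b\<close> does.\<close>

lemma ideal_avoiding_maximal_prime:
  fixes P :: "'a::comm_ring_1 set"
  assumes "ideal P type_ring" "1 \<in> S" "\<And>a b. a \<in> S \<Longrightarrow> b \<in> S \<Longrightarrow> a * b \<in> S" "P \<inter> S = {}"
    and max: "\<And>Q. ideal Q type_ring \<Longrightarrow> Q \<inter> S = {} \<Longrightarrow> P \<subseteq> Q \<Longrightarrow> Q = P"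
  shows "primeideal P type_ring"
  unfolding primeideal_type_ring_iff
proof (intro conjI allI impI)
  fix a b
  assume ab: "a * b \<in> P"
  show "a \<in> P \<or> b \<in> P"
  proof (rule ccontr)
    have meets: "\<exists>x y. x \<in> P \<and> x + y * c \<in> S" if "c \<notin> P" for c
    proof -
      let ?Q = "{x + y * c | x y. x \<in> P}"
      have "ideal ?Q type_ring"
        unfolding ideal_type_ring_iff
      proof (intro conjI ballI allI)
        show "0 \<in> ?Q"
          using assms(1) unfolding ideal_type_ring_iff by (auto intro!: exI[of _ 0])
        fix u assume "u \<in> ?Q"
        then obtain x y where u: "u = x + y * c" "x \<in> P" by blast
        show "z * u \<in> ?Q" for z
          using u assms(1) unfolding ideal_type_ring_iff
          by (intro CollectI exI[of _ "z * x"] exI[of _ "z * y"]) (simp add: algebra_simps)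
        fix v assume "v \<in> ?Q"
        then obtain x' y' where v: "v = x' + y' * c" "x' \<in> P" by blast
        show "u + v \<in> ?Q"
          using u v assms(1) unfolding ideal_type_ring_iff
          by (intro CollectI exI[of _ "x + x'"] exI[of _ "y + y'"]) (simp add: algebra_simps)
      qed
      moreover have "P \<subseteq> ?Q"
        by (metis (mono_tags, lifting) add_0_right mem_Collect_eq mult_zero_left subsetI)
      moreover have "c \<in> ?Q"
        using assms(1) unfolding ideal_type_ring_iff
        by (intro CollectI exI[of _ 0] exI[of _ 1]) simp
      ultimately show ?thesis
        using max[of ?Q] that by blast
    qed
    assume "\<not> (a \<in> P \<or> b \<in> P)"
    then obtain x y x' y' where
      *: "x \<in> P" "x' \<in> P" "x + y * a \<in> S" "x' + y' * b \<in> S"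
      using meets by blast
    \<comment> \<open>In this arrangement every summand has a factor \<open>x\<close>,
      \<open>x'\<close> or \<open>a * b\<close> from \<open>P\<close>.\<close>
    have "(x + y * a) * (x' + y' * b) = (x' + y' * b) * x + ((y * a) * x' + (y * y') * (a * b))"
      by (simp add: algebra_simps)
    also have "\<dots> \<in> P"
      using * ab assms(1) unfolding ideal_type_ring_iff by blast
    finally show False
      using assms(3)[OF *(3,4)] assms(4) by blast
  qed
qed (use assms in auto)

text \<open>Zorn's lemma applies to the ideals that contain \<open>I\<close> and are disjoint from
  \<open>S\<close>, because unions of nonempty chains stay in this family; a maximal member is prime
  by the previous lemma.\<close>

lemma exists_prime_avoiding:
  fixes I :: "'a::comm_ring_1 set"
  assumes "ideal I type_ring" "1 \<in> S" "\<And>a b. a \<in> S \<Longrightarrow> b \<in> S \<Longrightarrow> a * b \<in> S" "I \<inter> S = {}"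
  shows "\<exists>P. primeideal P type_ring \<and> I \<subseteq> P \<and> P \<inter> S = {}"
proof -
  let ?A = "{Q. ideal Q type_ring \<and> I \<subseteq> Q \<and> Q \<inter> S = {}}"
  have "\<exists>M\<in>?A. \<forall>Z\<in>?A. M \<subseteq> Z \<longrightarrow> Z = M"
  proof (rule subset_Zorn_nonempty)
    show "?A \<noteq> {}" using assms by auto
    fix C
    assume ne: "C \<noteq> {}" and ch: "subset.chain ?A C"
    then have C: "C \<subseteq> ?A" and tot: "\<And>Z Y. Z \<in> C \<Longrightarrow> Y \<in> C \<Longrightarrow> Z \<subseteq> Y \<or> Y \<subseteq> Z"
      unfolding subset_chain_def by blast+
    have "ideal (\<Union>C) type_ring"
      unfolding ideal_type_ring_iff
    proof (intro conjI ballI allI)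
      show "0 \<in> \<Union>C" using ne C by (auto simp: ideal_type_ring_iff)
      fix a assume a: "a \<in> \<Union>C"
      show "x * a \<in> \<Union>C" for x using a C unfolding ideal_type_ring_iff by blast
      fix b assume "b \<in> \<Union>C"
      with a tot obtain Z where "Z \<in> C" "a \<in> Z" "b \<in> Z" by blast
      then show "a + b \<in> \<Union>C" using C unfolding ideal_type_ring_iff by blast
    qed
    then show "\<Union>C \<in> ?A" using ne C by blast
  qed
  then obtain M where M: "ideal M type_ring" "I \<subseteq> M" "M \<inter> S = {}"
    and max: "\<forall>Z\<in>?A. M \<subseteq> Z \<longrightarrow> Z = M" by auto
  have "primeideal M type_ring"
  proof (rule ideal_avoiding_maximal_prime[of _ S])
    show "Q = M" if "ideal Q type_ring" "Q \<inter> S = {}" "M \<subseteq> Q" for Q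
      using max that M(2) by blast
  qed (use M(1,3) assms(2,3) in blast)+
  then show ?thesis using M(2,3) by blast
qed

text \<open>Zorn's lemma downwards: the intersection of a nonempty chain of primes is prime, because
  for two elements outside it some single member of the chain misses both.\<close>

lemma exists_minimal_prime_below:
  fixes I :: "'a::comm_ring_1 set"
  assumes "primeideal P type_ring" "I \<subseteq> P"
  shows "\<exists>Q \<in> minimal_primes type_ring I. Q \<subseteq> P"
proof -
  \<comment> \<open>complements turn the descending chains of primes into ascending ones\<close>
  let ?A = "{- Q | Q. primeideal Q type_ring \<and> I \<subseteq> Q \<and> Q \<subseteq> P}"
  have "\<exists>M\<in>?A. \<forall>Z\<in>?A. M \<subseteq> Z \<longrightarrow> Z = M"
  proof (rule subset_Zorn_nonempty)
    show "?A \<noteq> {}" using assms by auto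
    fix C
    assume ne: "C \<noteq> {}" and ch: "subset.chain ?A C"
    then have C: "C \<subseteq> ?A" and tot: "\<And>Z Y. Z \<in> C \<Longrightarrow> Y \<in> C \<Longrightarrow> Z \<subseteq> Y \<or> Y \<subseteq> Z"
      unfolding subset_chain_def by blast+
    have pr: "primeideal (- Z) type_ring" "I \<subseteq> - Z" "- Z \<subseteq> P" if "Z \<in> C" for Z
      using C that by auto
    have "ideal (- \<Union>C) type_ring"
      unfolding ideal_type_ring_iff
    proof (intro conjI ballI allI)
      show "0 \<in> - \<Union>C"
        using pr(1) unfolding primeideal_type_ring_iff ideal_type_ring_iff by blast
      fix a assume a: "a \<in> - \<Union>C"
      show "x * a \<in> - \<Union>C" for x
        using pr(1) a unfolding primeideal_type_ring_iff ideal_type_ring_iff by blast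
      fix b assume "b \<in> - \<Union>C"
      then show "a + b \<in> - \<Union>C"
        using pr(1) a unfolding primeideal_type_ring_iff ideal_type_ring_iff by blast
    qed
    moreover have "1 \<notin> - \<Union>C"
      using pr(1) ne unfolding primeideal_type_ring_iff by auto
    moreover have "a \<in> - \<Union>C \<or> b \<in> - \<Union>C" if ab: "a * b \<in> - \<Union>C" for a b
    proof (rule ccontr)
      assume "\<not> (a \<in> - \<Union>C \<or> b \<in> - \<Union>C)"
      with tot obtain Z where "Z \<in> C" "a \<in> Z" "b \<in> Z" by blast
      then show False using pr(1)[of Z] ab unfolding primeideal_type_ring_iff by blast
    qed
    ultimately have "primeideal (- \<Union>C) type_ring"
      unfolding primeideal_type_ring_iff by blast
    moreover have "I \<subseteq> - \<Union>C" "- \<Union>C \<subseteq> P"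
      using pr ne by blast+
    ultimately show "\<Union>C \<in> ?A"
      by (intro CollectI exI[of _ "- \<Union>C"]) simp
  qed
  then obtain Q where Q: "primeideal Q type_ring" "I \<subseteq> Q" "Q \<subseteq> P"
    and max: "\<forall>Z\<in>?A. - Q \<subseteq> Z \<longrightarrow> Z = - Q" by blast
  have "Q' = Q" if "primeideal Q' type_ring" "I \<subseteq> Q'" "Q' \<subseteq> Q" for Q'
  proof -
    have "- Q' \<in> ?A" "- Q \<subseteq> - Q'"
      using that Q(3) by blast+
    then show ?thesis using max by blast
  qed
  then show ?thesis using Q unfolding minimal_primes_def by blast
qed

section \<open>Basic properties of symbolic powers\<close>

lemma minimal_primes_of_prime:
  "primeideal P type_ring \<Longrightarrow> minimal_primes type_ring (P :: 'a::comm_ring_1 set) = {P}"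
  unfolding minimal_primes_def by blast

text \<open>The multiplier \<open>1\<close> lies in no prime ideal.\<close>

lemma ideal_power_subset_symbolic_power:
  "ideal_power type_ring I t \<subseteq> symbolic_power type_ring (I :: 'a::comm_ring_1 set) t"
  unfolding symbolic_power_def minimal_primes_def
  by (auto simp: primeideal_type_ring_iff intro!: exI[of _ 1])

text \<open>A multiplier outside all minimal primes of \<open>I\<close> is in particular outside
  \<open>P\<close>, which is its own only minimal prime.\<close>

lemma symbolic_power_subset_minimal_prime:
  fixes I :: "'a::comm_ring_1 set"
  assumes "P \<in> minimal_primes type_ring I"
  shows "symbolic_power type_ring I t \<subseteq> symbolic_power type_ring P t"
proof
  have P: "primeideal P type_ring" "I \<subseteq> P"
    using assms unfolding minimal_primes_def by auto
  fix a
  assume "a \<in> symbolic_power type_ring I t"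
  then obtain w where "w \<notin> \<Union>(minimal_primes type_ring I)" "w * a \<in> ideal_power type_ring I t"
    unfolding symbolic_power_def by auto
  then have "w \<notin> P" "w * a \<in> ideal_power type_ring P t"
    using assms P ideal_power_mono[of P I t] by (auto simp: primeideal_type_ring_iff)
  then show "a \<in> symbolic_power type_ring P t"
    unfolding symbolic_power_def minimal_primes_of_prime[OF P(1)] by auto
qed

text \<open>The complement of a union of primes is closed under multiplication, so the product of
  two multipliers serves for the sum of two elements.\<close>

lemma ideal_symbolic_power:
  fixes I :: "'a::comm_ring_1 set"
  assumes "ideal I type_ring"
  shows "ideal (symbolic_power type_ring I t) type_ring"
proof -
  have I: "ideal (ideal_power type_ring I t) type_ring"
    by (rule ideal_ideal_power[OF assms])
  let ?U = "\<Union>(minimal_primes type_ring I)"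
  have mult: "v * w \<notin> ?U" if "v \<notin> ?U" "w \<notin> ?U" for v w
    using that unfolding minimal_primes_def primeideal_type_ring_iff by blast
  have mem: "a \<in> symbolic_power type_ring I t \<longleftrightarrow> (\<exists>w. w \<notin> ?U \<and> w * a \<in> ideal_power type_ring I t)" for a
    unfolding symbolic_power_def by simp
  show ?thesis
    unfolding ideal_type_ring_iff
  proof (intro conjI ballI allI)
    show "0 \<in> symbolic_power type_ring I t"
      using ideal_power_subset_symbolic_power[of I t] I unfolding ideal_type_ring_iff by blast
    fix a assume "a \<in> symbolic_power type_ring I t"
    then obtain w where w: "w \<notin> ?U" "w * a \<in> ideal_power type_ring I t" by (auto simp: mem)
    show "x * a \<in> symbolic_power type_ring I t" for x
    proof -
      have "x * (w * a) \<in> ideal_power type_ring I t"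
        using w(2) I unfolding ideal_type_ring_iff by blast
      then show ?thesis
        using w(1) unfolding mem by (metis mult.left_commute)
    qed
    fix b assume "b \<in> symbolic_power type_ring I t"
    then obtain v where v: "v \<notin> ?U" "v * b \<in> ideal_power type_ring I t" by (auto simp: mem)
    have "(v * w) * (a + b) = v * (w * a) + w * (v * b)"
      by (simp add: algebra_simps)
    also have "\<dots> \<in> ideal_power type_ring I t"
      using v w I unfolding ideal_type_ring_iff by blast
    finally show "a + b \<in> symbolic_power type_ring I t"
      unfolding mem using mult v(1) w(1) by blast
  qed
qed

subsection \<open>Monomials and monomial ideals\<close>

definition variable_monomial :: "'n \<Rightarrow> 'n monomial" where
  "variable_monomial i = Poly_Mapping.single i 1"

lemma lookup_variable_monomial: "Poly_Mapping.lookup (variable_monomial i) j = of_bool (i = j)"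
  by (simp add: variable_monomial_def lookup_single)

text \<open>The monomial ideal generated by \<open>M\<close>, encoded by supports instead of linear
  combinations so that membership is tested one monomial at a time;
  \<open>genideal_monomial_poly\<close> identifies it with the generated ideal.\<close>

definition monomials_ideal :: "'n monomial set \<Rightarrow> ('n::finite, 'k::field) mpolynomial set" where
  "monomials_ideal M = {f. \<forall>k \<in> Poly_Mapping.keys f. \<exists>m\<in>M. \<exists>v. k = m + v}"

lemma sum_single_keys:
  "(\<Sum>k\<in>Poly_Mapping.keys f. Poly_Mapping.single k (Poly_Mapping.lookup f k)) = f"
  by (rule poly_mapping_eqI) (auto simp: lookup_sum lookup_single when_def in_keys_iff)

lemma single_eq_mult_monomial_poly:
  "Poly_Mapping.single (m + v) c = Poly_Mapping.single v c * (monomial_poly m :: ('n::finite, 'k::field) mpolynomial)"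
  by (simp add: mult_single add.commute)

text \<open>A polynomial is the sum of its terms, and each term here is a multiple of a monomial in
  \<open>I\<close>.\<close>

lemma ideal_memI_singles:
  fixes I :: "('n::finite, 'k::field) mpolynomial set"
  assumes "ideal I polynomial_ring" "\<And>k. k \<in> Poly_Mapping.keys f \<Longrightarrow> \<exists>m v. k = m + v \<and> monomial_poly m \<in> I"
  shows "f \<in> I"
proof -
  have "Poly_Mapping.single k (Poly_Mapping.lookup f k) \<in> I" if "k \<in> Poly_Mapping.keys f" for k
  proof -
    obtain m v where k: "k = m + v" and "monomial_poly m \<in> I"
      using assms(2)[OF \<open>k \<in> _\<close>] by blast
    then show ?thesis
      using assms(1) unfolding k single_eq_mult_monomial_poly ideal_type_ring_iff by blast
  qed
  then have "(\<Sum>k\<in>Poly_Mapping.keys f. Poly_Mapping.single k (Poly_Mapping.lookup f k)) \<in> I"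
    by (rule ideal_sum_closed[OF assms(1)])
  then show ?thesis by (simp only: sum_single_keys)
qed

lemma ideal_monomials_ideal:
  "ideal (monomials_ideal M :: ('n::finite, 'k::field) mpolynomial set) polynomial_ring"
  unfolding ideal_type_ring_iff
proof (intro conjI ballI allI)
  fix f :: "('n, 'k) mpolynomial"
  assume f: "f \<in> monomials_ideal M"
  show "g * f \<in> monomials_ideal M" for g
    unfolding monomials_ideal_def
  proof (intro CollectI ballI)
    fix k
    assume "k \<in> Poly_Mapping.keys (g * f)"
    then obtain a b where "k = a + b" "b \<in> Poly_Mapping.keys f"
      using keys_mult[of g f] by blast
    moreover obtain m v where "b = m + v" "m \<in> M"
      using f calculation unfolding monomials_ideal_def by blast
    ultimately show "\<exists>m\<in>M. \<exists>v. k = m + v"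
      by (intro bexI[of _ m] exI[of _ "a + v"]) (simp_all add: ac_simps)
  qed
  show "f + g \<in> monomials_ideal M" if "g \<in> monomials_ideal M" for g
    using f that keys_add[of f g] unfolding monomials_ideal_def by blast
qed (simp add: monomials_ideal_def)

lemma monomial_poly_mem_monomials_ideal:
  "m \<in> M \<Longrightarrow> monomial_poly m \<in> (monomials_ideal M :: ('n::finite, 'k::field) mpolynomial set)"
  unfolding monomials_ideal_def by (auto intro!: bexI[of _ m] exI[of _ 0])

lemma genideal_monomial_poly:
  "Idl\<^bsub>polynomial_ring\<^esub> (monomial_poly ` M) = (monomials_ideal M :: ('n::finite, 'k::field) mpolynomial set)"
proof
  show "Idl\<^bsub>polynomial_ring\<^esub> (monomial_poly ` M) \<subseteq> (monomials_ideal M :: ('n, 'k) mpolynomial set)"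
    by (rule genideal_least[OF ideal_monomials_ideal]) (auto intro: monomial_poly_mem_monomials_ideal)
  show "(monomials_ideal M :: ('n, 'k) mpolynomial set) \<subseteq> Idl\<^bsub>polynomial_ring\<^esub> (monomial_poly ` M)"
  proof
    fix f :: "('n, 'k) mpolynomial"
    assume "f \<in> monomials_ideal M"
    then show "f \<in> Idl\<^bsub>polynomial_ring\<^esub> (monomial_poly ` M)"
      using genideal_superset[of "monomial_poly ` M :: ('n, 'k) mpolynomial set"]
      unfolding monomials_ideal_def by (intro ideal_memI_singles[OF ideal_genideal]) blast
  qed
qed

lemma monomial_eq_plus_diff:
  fixes u v :: "'n monomial"
  assumes "\<And>i. Poly_Mapping.lookup v i \<le> Poly_Mapping.lookup u i"
  shows "u = v + (u - v)"
  by (rule poly_mapping_eqI) (use assms in \<open>simp add: lookup_add lookup_minus\<close>)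

lemma monomial_eq_variable_plus:
  fixes u :: "'n monomial"
  assumes "0 < Poly_Mapping.lookup u i"
  obtains v where "u = variable_monomial i + v"
  by (rule that, rule monomial_eq_plus_diff) (use assms in \<open>auto simp: lookup_variable_monomial\<close>)

lemma mem_monomials_ideal_variables:
  "f \<in> monomials_ideal (variable_monomial ` C) \<longleftrightarrow>
    (\<forall>k\<in>Poly_Mapping.keys f. \<exists>i\<in>C. 0 < Poly_Mapping.lookup k i)"
proof -
  have "(\<exists>m\<in>variable_monomial ` C. \<exists>v. k = m + v) \<longleftrightarrow> (\<exists>i\<in>C. 0 < Poly_Mapping.lookup k i)"
    for k :: "'a monomial"
    by (auto simp: lookup_add lookup_variable_monomial) (metis monomial_eq_variable_plus)
  then show ?thesis unfolding monomials_ideal_def by simp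
qed

text \<open>A monomial is a product of variables, and a prime containing a product contains a
  factor. The induction on the degree splits off one variable at a time.\<close>

lemma prime_contains_variable:
  fixes Q :: "('n::finite, 'k::field) mpolynomial set"
  assumes "primeideal Q polynomial_ring" "monomial_poly m \<in> Q"
  shows "\<exists>i. 0 < Poly_Mapping.lookup m i \<and> monomial_poly (variable_monomial i) \<in> Q"
  using assms(2)
proof (induction "monomial_degree m" arbitrary: m rule: less_induct)
  case less
  \<comment> \<open>The exponent vector \<open>0\<close> stands for the polynomial \<open>1\<close>,
    which no prime contains.\<close>
  have "m \<noteq> 0"
    using less.prems assms(1) by (auto simp: primeideal_type_ring_iff)
  then obtain i where "0 < Poly_Mapping.lookup m i"
    by (metis gr0I lookup_zero poly_mapping_eqI)
  then obtain v where v: "m = variable_monomial i + v"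
    by (rule monomial_eq_variable_plus)
  have "monomial_poly m = monomial_poly (variable_monomial i) * (monomial_poly v :: ('n, 'k) mpolynomial)"
    unfolding v by (simp add: mult_single)
  then consider "monomial_poly (variable_monomial i) \<in> Q" | "monomial_poly v \<in> Q"
    using less.prems assms(1) by (auto simp: primeideal_type_ring_iff)
  then show ?case
  proof cases
    case 1
    then show ?thesis using \<open>0 < Poly_Mapping.lookup m i\<close> by blast
  next
    case 2
    have "monomial_degree v < monomial_degree m"
      unfolding v monomial_degree_def
      by (rule sum_strict_mono_ex1) (auto simp: lookup_add lookup_variable_monomial)
    then show ?thesis
      using less.hyps[OF _ 2] by (auto simp: v lookup_add)
  qed
qed

text \<open>Nothing can cancel at \<open>a + b\<close>: in the double sum over the supports only the
  pair \<open>(a, b)\<close> contributes. Uniqueness is a bare hypothesis, so it can come from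
  leading monomials or from the largest monomials in a part of the supports.\<close>

lemma lookup_mult_unique:
  fixes f g :: "('n::finite, 'k::field) mpolynomial"
  assumes "\<And>a' b'. a' \<in> Poly_Mapping.keys f \<Longrightarrow> b' \<in> Poly_Mapping.keys g \<Longrightarrow> a' + b' = a + b \<Longrightarrow> a' = a \<and> b' = b"
  shows "Poly_Mapping.lookup (f * g) (a + b) = Poly_Mapping.lookup f a * Poly_Mapping.lookup g b"
proof -
  let ?F = "Poly_Mapping.keys f" and ?G = "Poly_Mapping.keys g"
  have "f * g = (\<Sum>x\<in>?F. Poly_Mapping.single x (Poly_Mapping.lookup f x)) *
      (\<Sum>y\<in>?G. Poly_Mapping.single y (Poly_Mapping.lookup g y))"
    by (simp only: sum_single_keys)
  also have "\<dots> = (\<Sum>x\<in>?F. \<Sum>y\<in>?G.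
      Poly_Mapping.single (x + y) (Poly_Mapping.lookup f x * Poly_Mapping.lookup g y))"
    by (simp only: sum_product mult_single)
  finally have "Poly_Mapping.lookup (f * g) (a + b) = (\<Sum>x\<in>?F. \<Sum>y\<in>?G.
      (Poly_Mapping.lookup f x * Poly_Mapping.lookup g y when x + y = a + b))"
    by (simp add: lookup_sum lookup_single)
  also have "\<dots> = (\<Sum>x\<in>?F. \<Sum>y\<in>?G. if y = b then
      (if x = a then Poly_Mapping.lookup f a * Poly_Mapping.lookup g b else 0) else 0)"
    using assms by (intro sum.cong refl) (auto simp: when_def)
  also have "\<dots> = (if b \<in> ?G then if a \<in> ?F then Poly_Mapping.lookup f a * Poly_Mapping.lookup g b else 0 else 0)"
    by (simp only: sum.delta finite_keys sum.neutral_const if_distrib[of "sum _", symmetric]) simp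
  \<comment> \<open>If \<open>a\<close> or \<open>b\<close> is outside its support, its coefficient
    is \<open>0\<close> and both sides vanish.\<close>
  also have "\<dots> = Poly_Mapping.lookup f a * Poly_Mapping.lookup g b"
    by (auto simp: in_keys_iff)
  finally show ?thesis .
qed


subsection \<open>Monomial orders\<close>

text \<open>Every sequence has a monotone subsequence; a nonincreasing one of naturals is eventually
  constant, so a tail of it is nondecreasing.\<close>

lemma nat_seq_mono_subseq:
  fixes f :: "nat \<Rightarrow> nat"
  obtains r :: "nat \<Rightarrow> nat" where "strict_mono r" "mono (f \<circ> r)"
proof -
  obtain r where r: "strict_mono r" "monoseq (f \<circ> r)"
    using seq_monosub[of f] by (auto simp: comp_def)
  show ?thesis
  proof (cases "mono (f \<circ> r)")
    case False
    then have "antimono (f \<circ> r)"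
      using r(2) by (auto simp: monoseq_def mono_def antimono_def)
    \<comment> \<open>From an index \<open>N\<close> at which the minimum is attained, the antitone
      sequence is constant.\<close>
    moreover obtain N where "\<And>n. (f \<circ> r) N \<le> (f \<circ> r) n"
      using ex_has_least_nat[of "\<lambda>_. True" 0 "f \<circ> r"] by blast
    ultimately have N: "(f \<circ> r) n = (f \<circ> r) N" if "n \<ge> N" for n
      using that by (intro le_antisym) (auto dest: antimonoD)
    have "strict_mono (\<lambda>n. r (n + N))"
      using r(1) by (simp add: strict_mono_def)
    moreover have "mono (f \<circ> (\<lambda>n. r (n + N)))"
    proof (rule monoI)
      show "(f \<circ> (\<lambda>n. r (n + N))) x \<le> (f \<circ> (\<lambda>n. r (n + N))) y" for x y
        using N[of "x + N"] N[of "y + N"] by simp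
    qed
    ultimately show ?thesis by (rule that)
  qed (use r that in blast)
qed

text \<open>Dickson's lemma in sequence form: the previous lemma is applied to one variable after
  another, and nondecreasing exponents stay so in further subsequences.\<close>

lemma dickson_subseq:
  fixes u :: "nat \<Rightarrow> 'n::finite monomial"
  obtains r :: "nat \<Rightarrow> nat" where "strict_mono r" "\<And>i. mono (\<lambda>n. Poly_Mapping.lookup (u (r n)) i)"
proof -
  have "\<exists>r :: nat \<Rightarrow> nat. strict_mono r \<and> (\<forall>i\<in>A. mono (\<lambda>n. Poly_Mapping.lookup (u (r n)) i))" for A :: "'n set"
    using finite[of A]
  proof (induction A)
    case empty
    then show ?case by (auto intro: exI[of _ id] simp: strict_mono_def)
  next
    case (insert j A)
    then obtain r :: "nat \<Rightarrow> nat" where r: "strict_mono r" "\<forall>i\<in>A. mono (\<lambda>n. Poly_Mapping.lookup (u (r n)) i)" by blast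
    obtain s :: "nat \<Rightarrow> nat" where s: "strict_mono s" "mono ((\<lambda>n. Poly_Mapping.lookup (u (r n)) j) \<circ> s)"
      by (rule nat_seq_mono_subseq)
    have "strict_mono (r \<circ> s)" using r(1) s(1) by (rule strict_mono_o)
    moreover have "mono (\<lambda>n. Poly_Mapping.lookup (u ((r \<circ> s) n)) i)" if "i \<in> insert j A" for i
      using that r(2) s strict_mono_mono[OF s(1)] by (auto simp: mono_def)
    ultimately show ?case by blast
  qed
  from this[of UNIV] show ?thesis using that by auto
qed

context
  fixes lt :: "'n::finite monomial \<Rightarrow> 'n monomial \<Rightarrow> bool"
  assumes ord: "monomial_order lt"
begin

lemma lt_irrefl: "\<not> lt a a"
  using ord unfolding monomial_order_def irreflp_def by blast

lemma lt_trans: "lt a b \<Longrightarrow> lt b c \<Longrightarrow> lt a c"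
  using ord unfolding monomial_order_def transp_def by blast

lemma lt_total: "a \<noteq> b \<Longrightarrow> lt a b \<or> lt b a"
  using ord unfolding monomial_order_def totalp_on_def by blast

lemma lt_plus_left: "lt a b \<Longrightarrow> lt (c + a) (c + b)"
  using ord unfolding monomial_order_def by (metis add.commute)

lemma not_lt_plus: "\<not> lt (a + v) a"
proof
  assume *: "lt (a + v) a"
  then have "v \<noteq> 0" using lt_irrefl by auto
  then have "lt 0 v" using ord unfolding monomial_order_def by blast
  then have "lt (a + 0) (a + v)" by (rule lt_plus_left)
  then show False using * lt_trans lt_irrefl by fastforce
qed

text \<open>In an infinite descending chain Dickson's lemma finds an earlier monomial dividing a
  later one, but a multiple is never smaller.\<close>

lemma wfp_lt: "wfP lt"
  unfolding wfp_def wf_iff_no_infinite_down_chain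
proof
  assume "\<exists>u. \<forall>n. (u (Suc n), u n) \<in> {(x, y). lt x y}"
  then obtain u where u: "\<And>n. lt (u (Suc n)) (u n)" by auto
  have dec: "lt (u n) (u m)" if "m < n" for m n
    using that
  proof (induction n)
    case (Suc n)
    then consider "m = n" | "m < n" by linarith
    then show ?case using u[of n] Suc.IH lt_trans by cases blast+
  qed simp
  obtain r :: "nat \<Rightarrow> nat" where r: "strict_mono r" "\<And>i. mono (\<lambda>n. Poly_Mapping.lookup (u (r n)) i)"
    by (rule dickson_subseq[of u]) blast
  have eq: "u (r 1) = u (r 0) + (u (r 1) - u (r 0))"
    by (rule monomial_eq_plus_diff) (use r(2) in \<open>simp add: mono_def\<close>)
  have "lt (u (r 1)) (u (r 0))"
    by (rule dec) (use r(1) in \<open>simp add: strict_mono_def\<close>)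
  then have "lt (u (r 0) + (u (r 1) - u (r 0))) (u (r 0))"
    by (simp only: eq[symmetric])
  then show False using not_lt_plus by blast
qed

text \<open>Translation invariance makes addition strictly monotone in each summand, so the sum of
  two maxima is reached by no other pair. This supplies the uniqueness that
  \<open>lookup_mult_unique\<close> asks for.\<close>

lemma lt_add_maximal:
  assumes "a' = a \<or> lt a' a" "b' = b \<or> lt b' b"
  shows "a' + b' = a + b \<longleftrightarrow> a' = a \<and> b' = b" "a' + b' = a + b \<or> lt (a' + b') (a + b)"
proof -
  have strict: "lt (a' + b') (a + b)" if ne: "\<not> (a' = a \<and> b' = b)"
  proof (cases "a' = a")
    case True
    then show ?thesis using ne assms(2) lt_plus_left by blast
  next
    case False
    then have "lt (b' + a') (b' + a)" using assms(1) lt_plus_left by blast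
    then have *: "lt (a' + b') (a + b')" by (simp only: add.commute)
    show ?thesis
    proof (cases "b' = b")
      case True
      then show ?thesis using * by simp
    next
      case False
      then have "lt (a + b') (a + b)" using assms(2) lt_plus_left by blast
      with * show ?thesis by (rule lt_trans)
    qed
  qed
  then show "a' + b' = a + b \<or> lt (a' + b') (a + b)" by blast
  show "a' + b' = a + b \<longleftrightarrow> a' = a \<and> b' = b"
  proof
    assume eq: "a' + b' = a + b"
    show "a' = a \<and> b' = b"
    proof (rule ccontr)
      assume "\<not> (a' = a \<and> b' = b)"
      then have "lt (a' + b') (a + b)" by (rule strict)
      then show False unfolding eq using lt_irrefl by blast
    qed
  qed simp
qed

lemma exists_lt_maximum:
  assumes "finite A" "A \<noteq> {}"
  obtains m where "m \<in> A" "\<And>m'. m' \<in> A \<Longrightarrow> m' = m \<or> lt m' m"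
proof -
  have "\<exists>m\<in>A. \<forall>m'\<in>A. m' = m \<or> lt m' m"
    using assms
  proof (induction rule: finite_ne_induct)
    case (insert x F)
    then obtain m where m: "m \<in> F" "\<And>m'. m' \<in> F \<Longrightarrow> m' = m \<or> lt m' m" by blast
    consider "x = m" | "lt x m" | "lt m x" using lt_total by blast
    then show ?case
    proof cases
      case 1
      then show ?thesis using m by blast
    next
      case 2
      then show ?thesis using m by (intro bexI[of _ m]) blast+
    next
      case 3
      have "m' = x \<or> lt m' x" if "m' \<in> insert x F" for m'
        using that m(2)[of m'] 3 lt_trans[of m' m x] by blast
      then show ?thesis by blast
    qed
  qed simp
  then show ?thesis using that by blast
qed

section \<open>Leading monomials\<close>

lemma leading_monomial_eqI:
  assumes "m \<in> Poly_Mapping.keys f" "\<And>m'. m' \<in> Poly_Mapping.keys f \<Longrightarrow> m' = m \<or> lt m' m"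
  shows "leading_monomial lt f = m"
  unfolding leading_monomial_def
proof (rule the_equality)
  fix m'
  assume m': "m' \<in> Poly_Mapping.keys f \<and> (\<forall>k\<in>Poly_Mapping.keys f. k \<noteq> m' \<longrightarrow> lt k m')"
  show "m' = m"
  proof (rule ccontr)
    assume "m' \<noteq> m"
    then have "lt m' m" "lt m m'" using m' assms by auto
    then show False using lt_trans lt_irrefl by blast
  qed
qed (use assms in blast)

lemma leading_monomial_maximum:
  assumes "f \<noteq> 0"
  shows "leading_monomial lt f \<in> Poly_Mapping.keys f"
    and "m' \<in> Poly_Mapping.keys f \<Longrightarrow> m' = leading_monomial lt f \<or> lt m' (leading_monomial lt f)"
proof -
  obtain m where m: "m \<in> Poly_Mapping.keys f" "\<And>m'. m' \<in> Poly_Mapping.keys f \<Longrightarrow> m' = m \<or> lt m' m"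
    by (rule exists_lt_maximum[of "Poly_Mapping.keys f"]) (use assms in auto)
  then have "leading_monomial lt f = m" by (rule leading_monomial_eqI)
  with m show "leading_monomial lt f \<in> Poly_Mapping.keys f"
    and "m' \<in> Poly_Mapping.keys f \<Longrightarrow> m' = leading_monomial lt f \<or> lt m' (leading_monomial lt f)"
    by auto
qed

text \<open>The sum of the leading monomials arises from no other pair, so its coefficient is the
  product of the leading coefficients, which is nonzero in a field.\<close>

lemma leading_monomial_mult:
  fixes f g :: "('n, 'k::field) mpolynomial"
  assumes "f \<noteq> 0" "g \<noteq> 0"
  shows "f * g \<noteq> 0"
    and "leading_monomial lt (f * g) = leading_monomial lt f + leading_monomial lt g"
proof -
  let ?a = "leading_monomial lt f" and ?b = "leading_monomial lt g"
  note f = leading_monomial_maximum[OF assms(1)] and g = leading_monomial_maximum[OF assms(2)]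
  have "Poly_Mapping.lookup (f * g) (?a + ?b) = Poly_Mapping.lookup f ?a * Poly_Mapping.lookup g ?b"
    by (rule lookup_mult_unique) (use f g lt_add_maximal(1) in blast)
  then have *: "?a + ?b \<in> Poly_Mapping.keys (f * g)"
    using f(1) g(1) by (simp add: in_keys_iff)
  then show "f * g \<noteq> 0" by auto
  show "leading_monomial lt (f * g) = ?a + ?b"
  proof (rule leading_monomial_eqI[OF *])
    fix m
    assume "m \<in> Poly_Mapping.keys (f * g)"
    then obtain a b where "m = a + b" "a \<in> Poly_Mapping.keys f" "b \<in> Poly_Mapping.keys g"
      using keys_mult[of f g] by blast
    then show "m = ?a + ?b \<or> lt m (?a + ?b)"
      using f(2) g(2) lt_add_maximal(2) by blast
  qed
qed

lemma leading_monomial_single [simp]: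
  "c \<noteq> 0 \<Longrightarrow> leading_monomial lt (Poly_Mapping.single m c) = m"
  by (rule leading_monomial_eqI) auto

text \<open>For two polynomials outside the ideal, take in each the largest monomial that avoids
  \<open>C\<close>. Their sum avoids \<open>C\<close> and occurs in the product with nonzero
  coefficient.\<close>

lemma primeideal_variables:
  "primeideal (monomials_ideal (variable_monomial ` C) :: ('n, 'k::field) mpolynomial set) polynomial_ring"
  unfolding primeideal_type_ring_iff
proof (intro conjI allI impI ideal_monomials_ideal)
  let ?off = "\<lambda>k::'n monomial. \<forall>i\<in>C. Poly_Mapping.lookup k i = 0"
  have mem: "f \<in> monomials_ideal (variable_monomial ` C) \<longleftrightarrow> (\<forall>k\<in>Poly_Mapping.keys f. \<not> ?off k)"
    for f :: "('n, 'k) mpolynomial"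
    by (simp add: mem_monomials_ideal_variables)
  show "(1 :: ('n, 'k) mpolynomial) \<notin> monomials_ideal (variable_monomial ` C)"
    unfolding mem by simp
  fix f g :: "('n, 'k) mpolynomial"
  assume fg: "f * g \<in> monomials_ideal (variable_monomial ` C)"
  show "f \<in> monomials_ideal (variable_monomial ` C) \<or> g \<in> monomials_ideal (variable_monomial ` C)"
  proof (rule ccontr)
    assume "\<not> ?thesis"
    then have ne: "{k\<in>Poly_Mapping.keys f. ?off k} \<noteq> {}" "{k\<in>Poly_Mapping.keys g. ?off k} \<noteq> {}"
      unfolding mem by blast+
    obtain a where a: "a \<in> {k\<in>Poly_Mapping.keys f. ?off k}"
      "\<And>m. m \<in> {k\<in>Poly_Mapping.keys f. ?off k} \<Longrightarrow> m = a \<or> lt m a"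
      by (rule exists_lt_maximum[OF _ ne(1)]) auto
    obtain b where b: "b \<in> {k\<in>Poly_Mapping.keys g. ?off k}"
      "\<And>m. m \<in> {k\<in>Poly_Mapping.keys g. ?off k} \<Longrightarrow> m = b \<or> lt m b"
      by (rule exists_lt_maximum[OF _ ne(2)]) auto
    have off: "?off (x + y) \<longleftrightarrow> ?off x \<and> ?off y" for x y
      by (auto simp: lookup_add)
    have "Poly_Mapping.lookup (f * g) (a + b) = Poly_Mapping.lookup f a * Poly_Mapping.lookup g b"
    proof (rule lookup_mult_unique)
      fix a' b'
      assume *: "a' \<in> Poly_Mapping.keys f" "b' \<in> Poly_Mapping.keys g" "a' + b' = a + b"
      \<comment> \<open>Exponents are naturals, so a sum avoiding \<open>C\<close> forces both
        summands to avoid \<open>C\<close>; only then does the maximality of \<open>a\<close> and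
        \<open>b\<close> apply to \<open>a'\<close> and \<open>b'\<close>.\<close>
      have "?off (a' + b')"
        unfolding *(3) off using a(1) b(1) by blast
      then have "a' = a \<or> lt a' a" "b' = b \<or> lt b' b"
        using a(2)[of a'] b(2)[of b'] *(1,2) off[of a' b'] by blast+
      then show "a' = a \<and> b' = b"
        using *(3) lt_add_maximal(1) by blast
    qed
    then have "a + b \<in> Poly_Mapping.keys (f * g)"
      using a(1) b(1) by (simp add: in_keys_iff)
    moreover have "?off (a + b)" using a(1) b(1) off[of a b] by simp
    ultimately show False using fg unfolding mem by blast
  qed
qed

section \<open>Initial ideals\<close>

lemma ideal_initial_ideal:
  "ideal (initial_ideal lt K :: ('n, 'k::field) mpolynomial set) polynomial_ring"
  unfolding initial_ideal_def by (rule ideal_genideal)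

lemma initial_ideal_eq_monomials_ideal:
  "initial_ideal lt (K :: ('n, 'k::field) mpolynomial set) =
     monomials_ideal {leading_monomial lt f | f. f \<in> K \<and> f \<noteq> 0}"
  unfolding initial_ideal_def genideal_monomial_poly[symmetric] by (rule arg_cong[where f = "genideal _"]) auto

lemma mem_initial_ideal:
  fixes K :: "('n, 'k::field) mpolynomial set"
  shows "f \<in> initial_ideal lt K \<longleftrightarrow>
    (\<forall>k\<in>Poly_Mapping.keys f. \<exists>g v. g \<in> K \<and> g \<noteq> 0 \<and> k = leading_monomial lt g + v)"
  unfolding initial_ideal_eq_monomials_ideal monomials_ideal_def by blast

lemma monomial_poly_leading_monomial_mem:
  fixes K :: "('n, 'k::field) mpolynomial set"
  assumes "f \<in> K" "f \<noteq> 0"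
  shows "monomial_poly (leading_monomial lt f) \<in> initial_ideal lt K"
  unfolding initial_ideal_eq_monomials_ideal using assms by (intro monomial_poly_mem_monomials_ideal) blast

text \<open>Reduction modulo \<open>A\<close>: a multiple of an element of \<open>A\<close> cancels
  the leading term of \<open>f\<close>, the remainder stays in \<open>B\<close> with a smaller
  leading monomial, and the order is well-founded.\<close>

lemma ideal_subset_if_leading_monomials_mem:
  fixes A B :: "('n, 'k::field) mpolynomial set"
  assumes A: "ideal A polynomial_ring" and B: "ideal B polynomial_ring" and "A \<subseteq> B"
    and init: "\<And>f. f \<in> B \<Longrightarrow> f \<noteq> 0 \<Longrightarrow> monomial_poly (leading_monomial lt f) \<in> initial_ideal lt A"
  shows "B \<subseteq> A"
proof
  fix f
  assume "f \<in> B"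
  then show "f \<in> A"
  proof (induction "leading_monomial lt f" arbitrary: f rule: wfp_induct_rule[OF wfp_lt])
    case (1 f)
    show ?case
    proof (cases "f = 0")
      case True
      then show ?thesis using A by (simp add: ideal_type_ring_iff)
    next
      case False
      let ?a = "leading_monomial lt f"
      obtain g v where g: "g \<in> A" "g \<noteq> 0" "?a = leading_monomial lt g + v"
        using init[OF 1(2) False] unfolding mem_initial_ideal by auto
      let ?b = "leading_monomial lt g"
      \<comment> \<open>The quotient of the leading coefficients, so that \<open>h\<close> and
        \<open>f\<close> share their leading term.\<close>
      let ?c = "Poly_Mapping.lookup f ?a / Poly_Mapping.lookup g ?b"
      define h where "h = Poly_Mapping.single v ?c * g"
      have cf: "Poly_Mapping.lookup f ?a \<noteq> 0" and cg: "Poly_Mapping.lookup g ?b \<noteq> 0"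
        using leading_monomial_maximum(1) False g(2) by (simp_all add: in_keys_iff[symmetric])
      have hA: "h \<in> A"
        using g(1) A unfolding h_def ideal_type_ring_iff by blast
      have s: "Poly_Mapping.single v ?c \<noteq> 0"
        using cf cg by (metis divide_eq_0_iff lookup_single_eq lookup_zero)
      have h: "h \<noteq> 0" "leading_monomial lt h = ?a"
        using leading_monomial_mult[OF s g(2)] cf cg g(3) unfolding h_def by (simp_all add: add.commute)
      have "Poly_Mapping.lookup h (v + ?b) = Poly_Mapping.lookup (Poly_Mapping.single v ?c) v * Poly_Mapping.lookup g ?b"
        unfolding h_def by (rule lookup_mult_unique) (auto split: if_splits)
      then have "Poly_Mapping.lookup h ?a = Poly_Mapping.lookup f ?a"
        using cg by (simp add: g(3) add.commute)
      then have zero: "Poly_Mapping.lookup (f - h) ?a = 0"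
        by (simp add: lookup_minus)
      have fh: "f - h \<in> B"
        using ideal_minus_closed[OF B 1(2)] hA \<open>A \<subseteq> B\<close> by blast
      have "f - h \<in> A"
      proof (cases "f - h = 0")
        case True
        then show ?thesis using A by (simp add: ideal_type_ring_iff)
      next
        case nz: False
        let ?m = "leading_monomial lt (f - h)"
        have "?m \<in> Poly_Mapping.keys (f - h)" by (rule leading_monomial_maximum(1)[OF nz])
        \<comment> \<open>The coefficient at \<open>?a\<close> has cancelled, and all other
          monomials of \<open>f\<close> and \<open>h\<close> lie below \<open>?a\<close>.\<close>
        then have "?m \<noteq> ?a" "?m \<in> Poly_Mapping.keys f \<union> Poly_Mapping.keys h"
          using zero by (auto simp: in_keys_iff lookup_minus)
        then have "lt ?m ?a"
          using leading_monomial_maximum(2)[OF False, of ?m] leading_monomial_maximum(2)[OF h(1), of ?m] h(2)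
          by auto
        then show ?thesis using 1(1) fh by blast
      qed
      then have "(f - h) + h \<in> A" using hA A unfolding ideal_type_ring_iff by blast
      then show ?thesis by simp
    qed
  qed
qed

text \<open>A product of leading monomials is the leading monomial of the product.\<close>

lemma initial_ideal_power_subset:
  fixes K :: "('n, 'k::field) mpolynomial set"
  shows "ideal_power polynomial_ring (initial_ideal lt K) n \<subseteq> initial_ideal lt (ideal_power polynomial_ring K n)"
proof (induction n)
  case 0
  \<comment> \<open>The zeroth power is the whole ring, so the initial ideal of the whole ring has
    to contain \<open>1\<close>.\<close>
  have "monomial_poly 0 \<in> (initial_ideal lt UNIV :: ('n, 'k) mpolynomial set)"
    using monomial_poly_leading_monomial_mem[of "1 :: ('n, 'k) mpolynomial" UNIV]
      leading_monomial_single[of "1 :: 'k" 0] by simp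
  then have "f * 1 \<in> initial_ideal lt UNIV" for f :: "('n, 'k) mpolynomial"
    using ideal_initial_ideal[of "UNIV :: ('n, 'k) mpolynomial set"]
    unfolding ideal_type_ring_iff single_one by blast
  then show ?case by auto
next
  case (Suc n)
  show ?case
    unfolding ideal_power_Suc
  proof (rule ideal_prod_least[OF ideal_initial_ideal])
    fix f g :: "('n, 'k) mpolynomial"
    assume "f \<in> ideal_power polynomial_ring (initial_ideal lt K) n" and g: "g \<in> initial_ideal lt K"
    then have f: "f \<in> initial_ideal lt (ideal_power polynomial_ring K n)" using Suc by blast
    show "f * g \<in> initial_ideal lt (ideal_prod polynomial_ring (ideal_power polynomial_ring K n) K)"
      unfolding mem_initial_ideal
    proof
      fix k
      assume "k \<in> Poly_Mapping.keys (f * g)"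
      then obtain a b where k: "k = a + b" "a \<in> Poly_Mapping.keys f" "b \<in> Poly_Mapping.keys g"
        using keys_mult[of f g] by blast
      obtain p u where p: "p \<in> ideal_power polynomial_ring K n" "p \<noteq> 0" "a = leading_monomial lt p + u"
        using f k(2) unfolding mem_initial_ideal by blast
      obtain q v where q: "q \<in> K" "q \<noteq> 0" "b = leading_monomial lt q + v"
        using g k(3) unfolding mem_initial_ideal by blast
      show "\<exists>h v. h \<in> ideal_prod polynomial_ring (ideal_power polynomial_ring K n) K \<and> h \<noteq> 0 \<and>
          k = leading_monomial lt h + v"
        using leading_monomial_mult[OF p(2) q(2)] mult_mem_ideal_prod[OF p(1) q(1)] k(1) p(3) q(3)
        by (intro exI[of _ "p * q"] exI[of _ "u + v"]) (simp add: ac_simps)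
    qed
  qed
qed

text \<open>Leading monomials add, so \<open>?S\<close> is multiplicative; a prime is disjoint from
  \<open>?S\<close> exactly when its initial ideal lies in the ideal of the variables in
  \<open>C\<close>.\<close>

lemma exists_minimal_prime_initial_ideal_subset:
  fixes K :: "('n, 'k::field) mpolynomial set"
  assumes "ideal K polynomial_ring" "initial_ideal lt K \<subseteq> monomials_ideal (variable_monomial ` C)"
  shows "\<exists>P \<in> minimal_primes polynomial_ring K.
    initial_ideal lt P \<subseteq> monomials_ideal (variable_monomial ` C)"
proof -
  let ?S = "{f :: ('n, 'k) mpolynomial. f \<noteq> 0 \<and> (\<forall>i\<in>C. Poly_Mapping.lookup (leading_monomial lt f) i = 0)}"
  have "K \<inter> ?S = {}"
    using monomial_poly_leading_monomial_mem[of _ K] assms(2)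
    by (fastforce simp: subset_iff mem_monomials_ideal_variables)
  moreover have "1 \<in> ?S"
    using leading_monomial_single[of "1::'k" 0] by simp
  moreover have "f * g \<in> ?S" if "f \<in> ?S" "g \<in> ?S" for f g
    using that leading_monomial_mult[of f g] by (simp add: lookup_add)
  ultimately obtain P where "primeideal P polynomial_ring" "K \<subseteq> P" "P \<inter> ?S = {}"
    using exists_prime_avoiding[OF assms(1), of ?S] by blast
  \<comment> \<open>Shrinking to a minimal prime preserves disjointness from
    \<open>?S\<close>.\<close>
  then obtain Q where Q: "Q \<in> minimal_primes polynomial_ring K" "Q \<inter> ?S = {}"
    using exists_minimal_prime_below[of P K] by blast
  have "initial_ideal lt Q \<subseteq> monomials_ideal (variable_monomial ` C)"
  proof
    fix f
    assume f: "f \<in> initial_ideal lt Q"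
    show "f \<in> monomials_ideal (variable_monomial ` C)"
      unfolding mem_monomials_ideal_variables
    proof
      fix k
      assume "k \<in> Poly_Mapping.keys f"
      then obtain g v where "g \<in> Q" "g \<noteq> 0" "k = leading_monomial lt g + v"
        using f unfolding mem_initial_ideal by blast
      then show "\<exists>i\<in>C. 0 < Poly_Mapping.lookup k i"
        using Q(2) by (fastforce simp: lookup_add)
    qed
  qed
  with Q(1) show ?thesis by blast
qed

end

text \<open>The degree in the variables of \<open>C\<close> is additive, and every factor from the
  ideal contributes at least 1.\<close>

lemma keys_ideal_power_variables:
  fixes f :: "('n::finite, 'k::field) mpolynomial"
  assumes "f \<in> ideal_power polynomial_ring (monomials_ideal (variable_monomial ` C)) n"
    and "k \<in> Poly_Mapping.keys f"
  shows "n \<le> (\<Sum>i\<in>C. Poly_Mapping.lookup k i)"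
proof -
  \<comment> \<open>An upper bound for the \<open>n\<close>-th power. The degree condition is stable
    under multiples, so it can be read off every monomial of a member.\<close>
  let ?D = "\<lambda>n. monomials_ideal {m. n \<le> (\<Sum>i\<in>C. Poly_Mapping.lookup m i)} :: ('n, 'k) mpolynomial set"
  have mem: "f \<in> ?D n \<longleftrightarrow> (\<forall>k\<in>Poly_Mapping.keys f. n \<le> (\<Sum>i\<in>C. Poly_Mapping.lookup k i))" for f n
  proof -
    have "(\<exists>m\<in>{m. n \<le> (\<Sum>i\<in>C. Poly_Mapping.lookup m i)}. \<exists>v. k = m + v) \<longleftrightarrow>
        n \<le> (\<Sum>i\<in>C. Poly_Mapping.lookup k i)" for k
      by (auto simp: lookup_add sum.distrib intro: exI[of _ k] exI[of _ "0 :: 'n monomial"])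
    then show ?thesis unfolding monomials_ideal_def by simp
  qed
  have "ideal_power polynomial_ring (monomials_ideal (variable_monomial ` C)) n \<subseteq> ?D n"
  proof (induction n)
    case 0
    have "f \<in> ?D 0" for f unfolding mem by simp
    then show ?case by blast
  next
    case (Suc n)
    show ?case
      unfolding ideal_power_Suc
    proof (rule ideal_prod_least[OF ideal_monomials_ideal])
      fix f g :: "('n, 'k) mpolynomial"
      assume "f \<in> ideal_power polynomial_ring (monomials_ideal (variable_monomial ` C)) n"
        and g: "g \<in> monomials_ideal (variable_monomial ` C)"
      then have f: "f \<in> ?D n" using Suc by blast
      show "f * g \<in> ?D (Suc n)"
        unfolding mem
      proof
        fix k
        assume "k \<in> Poly_Mapping.keys (f * g)"
        then obtain a b where k: "k = a + b" "a \<in> Poly_Mapping.keys f" "b \<in> Poly_Mapping.keys g"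
          using keys_mult[of f g] by blast
        have "n \<le> (\<Sum>i\<in>C. Poly_Mapping.lookup a i)" using f k(2) unfolding mem by blast
        moreover obtain i where "i \<in> C" "0 < Poly_Mapping.lookup b i"
          using g k(3) unfolding mem_monomials_ideal_variables by blast
        then have "0 < (\<Sum>i\<in>C. Poly_Mapping.lookup b i)"
          by (intro sum_pos2[of _ i]) auto
        ultimately show "Suc n \<le> (\<Sum>i\<in>C. Poly_Mapping.lookup k i)"
          by (simp add: k(1) lookup_add sum.distrib)
      qed
    qed
  qed
  then show ?thesis using assms mem by blast
qed


subsection \<open>Symbolic powers of squarefree monomial ideals\<close>

text \<open>Vertex covers of the hypergraph whose edges are the supports of the monomials in
  \<open>M\<close>.\<close>

definition covers :: "'n monomial set \<Rightarrow> 'n set \<Rightarrow> bool" where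
  "covers M C \<longleftrightarrow> (\<forall>m\<in>M. \<exists>i\<in>C. 0 < Poly_Mapping.lookup m i)"

definition minimal_cover :: "'n monomial set \<Rightarrow> 'n set \<Rightarrow> bool" where
  "minimal_cover M C \<longleftrightarrow> covers M C \<and> (\<forall>D. D \<subset> C \<longrightarrow> \<not> covers M D)"

text \<open>The squarefree product of the variables in \<open>A\<close>.\<close>

lift_definition indicator_monomial :: "'n::finite set \<Rightarrow> 'n monomial" is
  "\<lambda>A i. of_bool (i \<in> A)"
  by simp

lemma monomials_ideal_subset_variables_iff:
  "monomials_ideal M \<subseteq> (monomials_ideal (variable_monomial ` C) :: ('n::finite, 'k::field) mpolynomial set)
    \<longleftrightarrow> covers M C"
proof
  assume sub: "monomials_ideal M \<subseteq> (monomials_ideal (variable_monomial ` C) :: ('n, 'k) mpolynomial set)"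
  show "covers M C"
    unfolding covers_def
  proof
    fix m assume "m \<in> M"
    then have "monomial_poly m \<in> (monomials_ideal M :: ('n, 'k) mpolynomial set)"
      by (rule monomial_poly_mem_monomials_ideal)
    with sub show "\<exists>i\<in>C. 0 < Poly_Mapping.lookup m i"
      by (auto simp: subset_iff mem_monomials_ideal_variables)
  qed
next
  assume "covers M C"
  then show "monomials_ideal M \<subseteq> (monomials_ideal (variable_monomial ` C) :: ('n, 'k) mpolynomial set)"
    unfolding subset_iff mem_monomials_ideal_variables covers_def
    by (fastforce simp: monomials_ideal_def lookup_add)
qed

text \<open>The variables in \<open>Q\<close> cover \<open>M\<close> because \<open>Q\<close> is
  prime. A smaller cover \<open>D\<close> would generate a prime between the monomial ideal and
  \<open>Q\<close>, equal to \<open>Q\<close> by minimality, yet lacking a variable of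
  \<open>Q\<close>.\<close>

lemma minimal_cover_of_minimal_prime:
  fixes Q :: "('n::finite, 'k::field) mpolynomial set" and lt :: "'n monomial \<Rightarrow> 'n monomial \<Rightarrow> bool"
  assumes ord: "monomial_order lt" and Q: "Q \<in> minimal_primes polynomial_ring (monomials_ideal M)"
  shows "minimal_cover M {i. monomial_poly (variable_monomial i) \<in> Q}"
proof -
  let ?C = "{i. monomial_poly (variable_monomial i) \<in> Q}"
  have pr: "primeideal Q polynomial_ring" and sub: "monomials_ideal M \<subseteq> Q"
    and min: "\<And>P. primeideal P polynomial_ring \<Longrightarrow> monomials_ideal M \<subseteq> P \<Longrightarrow> P \<subseteq> Q \<Longrightarrow> P = Q"
    using Q unfolding minimal_primes_def by blast+
  have idQ: "ideal Q polynomial_ring" using pr by (simp add: primeideal_type_ring_iff)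
  have "covers M ?C"
    unfolding covers_def
  proof
    fix m assume "m \<in> M"
    then have "monomial_poly m \<in> (monomials_ideal M :: ('n, 'k) mpolynomial set)"
      by (rule monomial_poly_mem_monomials_ideal)
    then show "\<exists>i\<in>?C. 0 < Poly_Mapping.lookup m i"
      using prime_contains_variable[OF pr, of m] sub by blast
  qed
  moreover have "\<not> covers M D" if "D \<subset> ?C" for D
  proof
    let ?P = "monomials_ideal (variable_monomial ` D) :: ('n, 'k) mpolynomial set"
    assume "covers M D"
    then have "monomials_ideal M \<subseteq> ?P"
      by (simp add: monomials_ideal_subset_variables_iff)
    moreover have "?P \<subseteq> Q"
    proof
      fix f assume "f \<in> ?P"
      then show "f \<in> Q"
        using that unfolding monomials_ideal_def by (intro ideal_memI_singles[OF idQ]) blast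
    qed
    ultimately have "?P = Q" using min primeideal_variables[OF ord] by blast
    moreover obtain i where "i \<in> ?C" "i \<notin> D" using \<open>D \<subset> ?C\<close> by blast
    ultimately have "monomial_poly (variable_monomial i) \<in> ?P" by blast
    with \<open>i \<notin> D\<close> show False
      by (auto simp: mem_monomials_ideal_variables lookup_variable_monomial split: if_splits)
  qed
  ultimately show ?thesis unfolding minimal_cover_def by blast
qed

text \<open>By minimality some generator meets \<open>C\<close> only in the variable \<open>i\<close>, and being squarefree it
  divides the product of \<open>x\<^sub>i\<close> with all variables outside \<open>C\<close>.\<close>

lemma complement_times_variable_mem:
  fixes M :: "'n::finite monomial set"
  assumes "\<forall>m\<in>M. \<forall>i. Poly_Mapping.lookup m i \<le> 1" "minimal_cover M C" "i \<in> C"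
  shows "monomial_poly (indicator_monomial (- C)) * monomial_poly (variable_monomial i) \<in>
    (monomials_ideal M :: ('n, 'k::field) mpolynomial set)"
proof -
  have "C - {i} \<subset> C" using assms(3) by blast
  then obtain m where m: "m \<in> M" "\<And>j. j \<in> C - {i} \<Longrightarrow> Poly_Mapping.lookup m j = 0"
    using assms(2) unfolding minimal_cover_def covers_def by (metis gr0I)
  let ?u = "indicator_monomial (- C) + variable_monomial i"
  have "?u = m + (?u - m)"
  proof (rule monomial_eq_plus_diff)
    fix j
    show "Poly_Mapping.lookup m j \<le> Poly_Mapping.lookup ?u j"
      using assms(1,3) m(1) m(2)[of j]
      by (auto simp: lookup_add lookup_variable_monomial indicator_monomial.rep_eq)
  qed
  then show ?thesis
    using m(1) by (auto simp: mult_single monomials_ideal_def)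
qed

text \<open>Each of \<open>t\<close> variables of \<open>C\<close> taken out of \<open>u\<close> is
  paired with one copy of the product of the variables outside \<open>C\<close>; every such pair
  lies in the monomial ideal by the previous lemma.\<close>

lemma complement_power_times_monomial_mem:
  fixes M :: "'n::finite monomial set"
  assumes "\<forall>m\<in>M. \<forall>i. Poly_Mapping.lookup m i \<le> 1" "minimal_cover M C"
    and "t \<le> (\<Sum>i\<in>C. Poly_Mapping.lookup u i)"
  shows "monomial_poly (indicator_monomial (- C)) ^ t * monomial_poly u \<in>
    ideal_power polynomial_ring (monomials_ideal M :: ('n, 'k::field) mpolynomial set) t"
  using assms(3)
proof (induction t arbitrary: u)
  case 0
  then show ?case by simp
next
  case (Suc t)
  then have "(\<Sum>i\<in>C. Poly_Mapping.lookup u i) \<noteq> 0" by linarith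
  then obtain i where i: "i \<in> C" "0 < Poly_Mapping.lookup u i"
    by (metis gr0I sum.neutral)
  obtain v where u: "u = variable_monomial i + v"
    by (rule monomial_eq_variable_plus[OF i(2)])
  have "(\<Sum>j\<in>C. Poly_Mapping.lookup (variable_monomial i) j) = 1"
    using i(1) by (simp add: lookup_variable_monomial of_bool_def)
  then have "t \<le> (\<Sum>i\<in>C. Poly_Mapping.lookup v i)"
    using Suc.prems by (simp add: u lookup_add sum.distrib)
  let ?c = "monomial_poly (indicator_monomial (- C)) :: ('n, 'k) mpolynomial"
  have "(?c ^ t * monomial_poly v) * (?c * monomial_poly (variable_monomial i)) \<in>
      ideal_power polynomial_ring (monomials_ideal M) (Suc t)"
    unfolding ideal_power_Suc
    by (intro mult_mem_ideal_prod Suc.IH complement_times_variable_mem assms i(1)) fact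
  moreover have "monomial_poly u = monomial_poly (variable_monomial i) * (monomial_poly v :: ('n, 'k) mpolynomial)"
    by (simp add: u mult_single)
  ultimately show ?case by (simp only: power_Suc mult_ac)
qed

text \<open>The multiplier \<open>w\<close> is the sum over all minimal covers \<open>C\<close> of the \<open>t\<close>-th powers of the products of
  the variables outside \<open>C\<close>. Modulo a minimal prime \<open>P\<^sub>C\<close> only the summand of \<open>C\<close> survives, so one \<open>w\<close>
  avoids all minimal primes at once and no prime avoidance is needed.\<close>

lemma monomial_mem_symbolic_power:
  fixes M :: "'n::finite monomial set" and lt :: "'n monomial \<Rightarrow> 'n monomial \<Rightarrow> bool"
  assumes "monomial_order lt" "\<forall>m\<in>M. \<forall>i. Poly_Mapping.lookup m i \<le> 1" "t \<ge> 1"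
    and deg: "\<And>C. minimal_cover M C \<Longrightarrow> t \<le> (\<Sum>i\<in>C. Poly_Mapping.lookup u i)"
  shows "monomial_poly u \<in> symbolic_power polynomial_ring (monomials_ideal M :: ('n, 'k::field) mpolynomial set) t"
proof -
  let ?J = "monomials_ideal M :: ('n, 'k) mpolynomial set"
  let ?c = "\<lambda>C. monomial_poly (indicator_monomial (- C)) :: ('n, 'k) mpolynomial"
  define w where "w = (\<Sum>C | minimal_cover M C. ?c C ^ t)"
  have "w * monomial_poly u \<in> ideal_power polynomial_ring ?J t"
    unfolding w_def sum_distrib_right
    by (intro ideal_sum_closed ideal_ideal_power ideal_monomials_ideal
        complement_power_times_monomial_mem assms(2)) (auto intro: deg)
  moreover have "w \<notin> Q" if Q: "Q \<in> minimal_primes polynomial_ring ?J" for Q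
  proof
    assume w: "w \<in> Q"
    let ?C = "{i. monomial_poly (variable_monomial i) \<in> Q}"
    have C: "minimal_cover M ?C"
      by (rule minimal_cover_of_minimal_prime[OF assms(1) Q])
    have pr: "primeideal Q polynomial_ring" using Q unfolding minimal_primes_def by blast
    then have id: "ideal Q polynomial_ring" by (simp add: primeideal_type_ring_iff)
    have "?c D ^ t \<in> Q" if D: "minimal_cover M D" "D \<noteq> ?C" for D
    proof -
      \<comment> \<open>Distinct minimal covers do not contain one another, so \<open>?C\<close> has
        a variable outside \<open>D\<close>; it divides the product \<open>?c D\<close>.\<close>
      obtain i where i: "i \<in> ?C" "i \<notin> D"
        using C D unfolding minimal_cover_def by blast
      then obtain v where "indicator_monomial (- D) = variable_monomial i + v"
        using monomial_eq_variable_plus[of "indicator_monomial (- D)" i]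
        by (auto simp: indicator_monomial.rep_eq)
      then have "?c D = monomial_poly v * monomial_poly (variable_monomial i)"
        by (simp add: mult_single add.commute)
      then have "?c D \<in> Q" using id i(1) unfolding ideal_type_ring_iff by simp
      \<comment> \<open>With \<open>t\<close> positive the power really contains a factor
        \<open>?c D\<close>; a zeroth power would be \<open>1\<close>.\<close>
      moreover obtain s where "t = Suc s" using assms(3) by (cases t) auto
      ultimately show ?thesis using id unfolding ideal_type_ring_iff by (simp add: mult.commute)
    qed
    then have "w - (\<Sum>C | minimal_cover M C \<and> C \<noteq> ?C. ?c C ^ t) \<in> Q"
      by (intro ideal_minus_closed[OF id w] ideal_sum_closed[OF id]) auto
    moreover have "w = ?c ?C ^ t + (\<Sum>C | minimal_cover M C \<and> C \<noteq> ?C. ?c C ^ t)"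
      unfolding w_def using C by (subst sum.remove[of _ ?C]) (auto intro!: sum.cong)
    ultimately have "?c ?C ^ t \<in> Q"
      by simp
    \<comment> \<open>The surviving summand puts a variable outside \<open>?C\<close> into
      \<open>Q\<close>, against the choice of \<open>?C\<close>.\<close>
    then have "?c ?C \<in> Q" by (rule primeideal_power_mem[OF pr])
    then obtain i where "0 < Poly_Mapping.lookup (indicator_monomial (- ?C)) i" "i \<in> ?C"
      using prime_contains_variable[OF pr] by blast
    then show False by (simp add: indicator_monomial.rep_eq)
  qed
  ultimately show ?thesis unfolding symbolic_power_def by auto
qed

section \<open>Comparison of the initial ideals of the ordinary and the symbolic power\<close>

theorem lemma3p1:
  fixes I :: "('n::finite, 'k::field) mpolynomial set"
    and lt :: "'n monomial \<Rightarrow> 'n monomial \<Rightarrow> bool"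
    and t :: nat
  assumes "ideal I polynomial_ring"
    and "homogeneous_ideal I"
    and "monomial_order lt"
    and "squarefree_monomial_ideal (initial_ideal lt I)"
    and "initial_ideal lt I = (\<Inter>p \<in> minimal_primes polynomial_ring I. initial_ideal lt p)"
    and "t \<ge> 1"
    and "\<And>p. p \<in> minimal_primes polynomial_ring I \<Longrightarrow>
           symbolic_power polynomial_ring p t = ideal_power polynomial_ring p t"
    and "\<And>p. p \<in> minimal_primes polynomial_ring I \<Longrightarrow>
           initial_ideal lt (ideal_power polynomial_ring p t)
             = ideal_power polynomial_ring (initial_ideal lt p) t"
    and "symbolic_power polynomial_ring (initial_ideal lt I) t
           = ideal_power polynomial_ring (initial_ideal lt I) t"
  shows "symbolic_power polynomial_ring I t = ideal_power polynomial_ring I t"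
proof
  show "ideal_power polynomial_ring I t \<subseteq> symbolic_power polynomial_ring I t"
    by (rule ideal_power_subset_symbolic_power)
  obtain M where M: "\<forall>m\<in>M. \<forall>i. Poly_Mapping.lookup m i \<le> 1" "initial_ideal lt I = monomials_ideal M"
    using assms(4) unfolding squarefree_monomial_ideal_def genideal_monomial_poly by blast
  show "symbolic_power polynomial_ring I t \<subseteq> ideal_power polynomial_ring I t"
  \<comment> \<open>The ordinary power sits inside the symbolic one, so it suffices to place the
    leading monomials of the latter in the initial ideal of the former.\<close>
  proof (rule ideal_subset_if_leading_monomials_mem[OF assms(3)])
    fix a
    assume a: "a \<in> symbolic_power polynomial_ring I t" "a \<noteq> 0"
    let ?u = "leading_monomial lt a"
    have "t \<le> (\<Sum>i\<in>C. Poly_Mapping.lookup ?u i)" if "minimal_cover M C" for C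
    proof -
      let ?P = "monomials_ideal (variable_monomial ` C) :: ('n, 'k) mpolynomial set"
      have "covers M C" using that unfolding minimal_cover_def by blast
      then have "initial_ideal lt I \<subseteq> ?P"
        by (simp add: M(2) monomials_ideal_subset_variables_iff)
      then obtain p where p: "p \<in> minimal_primes polynomial_ring I" "initial_ideal lt p \<subseteq> ?P"
        using exists_minimal_prime_initial_ideal_subset[OF assms(3,1)] by blast
      \<comment> \<open>Condition (a) turns the symbolic power of \<open>p\<close> into the ordinary
        one; condition (b) then moves the leading monomial into the power of the initial
        ideal.\<close>
      have "a \<in> ideal_power polynomial_ring p t"
        using a(1) symbolic_power_subset_minimal_prime[OF p(1), of t] assms(7)[OF p(1)] by blast
      then have "monomial_poly ?u \<in> ideal_power polynomial_ring (initial_ideal lt p) t"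
        using monomial_poly_leading_monomial_mem[OF assms(3) _ a(2)] assms(8)[OF p(1)] by blast
      then have "monomial_poly ?u \<in> ideal_power polynomial_ring ?P t"
        using ideal_power_mono[OF ideal_monomials_ideal p(2)] by blast
      then show ?thesis
        by (rule keys_ideal_power_variables) simp
    qed
    \<comment> \<open>The degree bounds for all minimal covers give membership in the symbolic power
      of the initial ideal, which condition (c) makes ordinary.\<close>
    then have "monomial_poly ?u \<in> ideal_power polynomial_ring (initial_ideal lt I) t"
      using monomial_mem_symbolic_power[OF assms(3) M(1), of t ?u] assms(6,9) unfolding M(2) by blast
    then show "monomial_poly ?u \<in> initial_ideal lt (ideal_power polynomial_ring I t)"
      using initial_ideal_power_subset[OF assms(3)] by blast
  qed (intro ideal_ideal_power ideal_symbolic_power ideal_power_subset_symbolic_power assms(1))+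
qed

end
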